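(* Let $(X,\|\cdot\|)$ be a normed space, let $I:X\to\mathbb{R}$ be a Fréchet differentiable functional, and let $A\subset X$ be a subset of critical points of $I$. Suppose that for all $u,v\in A$ there exists a map $\gamma:[0,1]\to X$ such that (a) $\gamma(0)=u$ and $\gamma(1)=v$; (b) $\gamma$ is locally Lipschitz at $t=0$, that is, there are $\delta>0$ and $C$ such that $\|\gamma(t)-u\|\le Ct$ for each $t\in[0,\delta]$; (c) $t\mapsto I(\gamma(t))$ is convex in $[0,1]$. Then (i) $I$ is constant on $A$; (ii) $t\mapsto I(\gamma(t))$ is a constant function (for each such $\gamma$); (iii) if condition (c) holds with strict convexity for all $u\neq v$, then $A$ has at most one element.
   Context: A critical point of $I$ is a point $u\in X$ with $I'(u)=0$. *)

theory Defs
  imports "HOL-Analysis.Analysis"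
begin

definition critical_point :: "('a::real_normed_vector \<Rightarrow> real) \<Rightarrow> 'a \<Rightarrow> bool" where
  "critical_point I u \<longleftrightarrow> I differentiable (at u) \<and> frechet_derivative I (at u) = (\<lambda>h. 0)"

definition strictly_convex_on :: "'a::real_vector set \<Rightarrow> ('a \<Rightarrow> real) \<Rightarrow> bool" where
  "strictly_convex_on S f \<longleftrightarrow> convex S \<and>
    (\<forall>x\<in>S. \<forall>y\<in>S. \<forall>u>0. \<forall>v>0. x \<noteq> y \<longrightarrow> u + v = 1 \<longrightarrow>
      f (u *\<^sub>R x + v *\<^sub>R y) < u * f x + v * f y)"

text \<open>
  A map \<open>[0,1] \<rightarrow> X\<close> is a total function on the reals of which only the values on \<open>{0..1}\<close>
  matter; this is why \<open>\<delta> \<le> 1\<close> is required below. No continuity away from \<open>0\<close> is assumed.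
\<close>

definition joins :: "(real \<Rightarrow> 'a) \<Rightarrow> 'a \<Rightarrow> 'a \<Rightarrow> bool" where
  "joins \<gamma> u v \<longleftrightarrow> \<gamma> 0 = u \<and> \<gamma> 1 = v"

definition lipschitz_at_start :: "(real \<Rightarrow> 'a::real_normed_vector) \<Rightarrow> bool" where
  "lipschitz_at_start \<gamma> \<longleftrightarrow>
    (\<exists>\<delta> C. 0 < \<delta> \<and> \<delta> \<le> 1 \<and> (\<forall>t\<in>{0..\<delta>}. norm (\<gamma> t - \<gamma> 0) \<le> C * t))"

definition convex_link :: "('a::real_normed_vector \<Rightarrow> real) \<Rightarrow> 'a \<Rightarrow> 'a \<Rightarrow> (real \<Rightarrow> 'a) \<Rightarrow> bool" where
  "convex_link I u v \<gamma> \<longleftrightarrow>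
    joins \<gamma> u v \<and> lipschitz_at_start \<gamma> \<and> convex_on {0..1} (\<lambda>t. I (\<gamma> t))"

definition strictly_convex_link ::
    "('a::real_normed_vector \<Rightarrow> real) \<Rightarrow> 'a \<Rightarrow> 'a \<Rightarrow> (real \<Rightarrow> 'a) \<Rightarrow> bool" where
  "strictly_convex_link I u v \<gamma> \<longleftrightarrow>
    joins \<gamma> u v \<and> lipschitz_at_start \<gamma> \<and> strictly_convex_on {0..1} (\<lambda>t. I (\<gamma> t))"

end

theory Submission
  imports Defs
begin

text \<open>
  Along a path that is Lipschitz at its start, the vanishing derivative of \<open>I\<close> makes the right
  derivative of \<open>t \<mapsto> I (\<gamma> t)\<close> at \<open>0\<close> vanish, so by convexity the starting point is a minimum of
  \<open>I\<close> along the path. Exchanging the endpoints gives equal values at both ends, and convexity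
  bounds the values in between from above by this common value.
\<close>

text \<open>The epsilon-delta form of differentiability with derivative zero: near a critical point
  \<open>I\<close> varies by less than any prescribed linear rate.\<close>

lemma critical_point_small_o:
  assumes "critical_point I u" "0 < e"
  obtains d where "0 < d" "\<And>y. norm (y - u) < d \<Longrightarrow> \<bar>I y - I u\<bar> \<le> e * norm (y - u)"
proof -
  have "(I has_derivative (\<lambda>h. 0)) (at u)"
    using assms(1) iffD1[OF frechet_derivative_works, of I "at u"]
    by (auto simp: critical_point_def)
  then show thesis
    using assms(2) that unfolding has_derivative_at_alt by (metis diff_zero real_norm_def)
qed

text \<open>If \<open>I\<close> were lower at \<open>\<gamma> t\<close>, convexity would force a
  drop from \<open>I u\<close> of at least \<open>s\<close> times the gap at parameter
  \<open>s * t\<close>. The Lipschitz bound and the vanishing derivative allow only half of that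
  once \<open>s\<close> is small.\<close>

lemma convex_link_start_le:
  assumes crit: "critical_point I u" and link: "convex_link I u v \<gamma>" and t: "t \<in> {0..1}"
  shows "I u \<le> I (\<gamma> t)"
proof (rule ccontr)
  assume "\<not> I u \<le> I (\<gamma> t)"
  then have gap: "I (\<gamma> t) < I u" by simp
  have \<gamma>0: "\<gamma> 0 = u" and conv: "convex_on {0..1} (\<lambda>t. I (\<gamma> t))"
    and lip: "lipschitz_at_start \<gamma>"
    using link by (auto simp: convex_link_def joins_def)
  obtain \<delta> C where \<delta>: "0 < \<delta>" and C: "\<And>s. s \<in> {0..\<delta>} \<Longrightarrow> norm (\<gamma> s - u) \<le> C * s"
    using lip \<gamma>0 unfolding lipschitz_at_start_def by metis
  \<comment> \<open>\<open>C\<close> may be 0, while the next choices divide by the Lipschitz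
    constant.\<close>
  define K where "K = \<bar>C\<bar> + 1"
  have K: "0 < K" by (simp add: K_def)
  \<comment> \<open>With this rate, \<open>e * (K * s)\<close> is exactly half of the drop that
    convexity forces.\<close>
  define e where "e = (I u - I (\<gamma> t)) / (2 * K)"
  have e: "0 < e" using gap K by (simp add: e_def)
  obtain d where d: "0 < d" "\<And>y. norm (y - u) < d \<Longrightarrow> \<bar>I y - I u\<bar> \<le> e * norm (y - u)"
    using critical_point_small_o[OF crit e] by blast
  \<comment> \<open>The three bounds make \<open>s\<close> a convex weight, keep
    \<open>s * t\<close> in the Lipschitz range, and keep the path within distance \<open>d\<close>
    of \<open>u\<close>.\<close>
  define s where "s = min 1 (min \<delta> (d / (2 * K)))"
  have s: "0 < s" "s \<le> 1" "s \<le> \<delta>" "s \<le> d / (2 * K)"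
    using \<delta> d(1) K by (auto simp: s_def)
  have Ks: "K * s < d"
    using s(4) K d(1) by (simp add: field_simps)
  have st: "0 \<le> s * t" "s * t \<le> s"
    using s(1) t by (auto simp: mult_left_le)
  have "norm (\<gamma> (s * t) - u) \<le> C * (s * t)"
    using C st s(3) by simp
  also have "\<dots> \<le> K * (s * t)"
    using st(1) by (intro mult_right_mono) (auto simp: K_def)
  also have "\<dots> \<le> K * s"
    using st(2) K by simp
  finally have near: "norm (\<gamma> (s * t) - u) \<le> K * s" .
  then have "\<bar>I (\<gamma> (s * t)) - I u\<bar> \<le> e * (K * s)"
    using d(2)[of "\<gamma> (s * t)"] Ks mult_left_mono[OF near, of e] e by linarith
  also have "e * (K * s) = s * (I u - I (\<gamma> t)) / 2"
    using K by (simp add: e_def)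
  finally have lower: "I u - s * (I u - I (\<gamma> t)) / 2 \<le> I (\<gamma> (s * t))"
    by linarith
  \<comment> \<open>Here \<open>s * t\<close> is read as the convex combination of 0 and
    \<open>t\<close> with weight \<open>s\<close>.\<close>
  have "I (\<gamma> (s * t)) \<le> (1 - s) * I u + s * I (\<gamma> t)"
    using convex_onD[OF conv, of s 0 t] s t \<gamma>0 by simp
  also have "\<dots> = I u - s * (I u - I (\<gamma> t))"
    by (simp add: algebra_simps)
  finally have "s * (I u - I (\<gamma> t)) \<le> s * (I u - I (\<gamma> t)) / 2"
    using lower by linarith
  moreover have "0 < s * (I u - I (\<gamma> t))"
    using s(1) gap by simp
  ultimately show False by linarith
qed

lemma convex_link_endpoint_le:
  assumes "critical_point I u" "convex_link I u v \<gamma>"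
  shows "I u \<le> I v"
  using convex_link_start_le[OF assms, of 1] assms(2) by (simp add: convex_link_def joins_def)

lemma convex_link_constant:
  assumes crit: "critical_point I u" and link: "convex_link I u v \<gamma>" and eq: "I v = I u"
    and t: "t \<in> {0..1}"
  shows "I (\<gamma> t) = I u"
proof (rule antisym)
  have ends: "\<gamma> 0 = u" "\<gamma> 1 = v" and conv: "convex_on {0..1} (\<lambda>t. I (\<gamma> t))"
    using link by (auto simp: convex_link_def joins_def)
  show "I (\<gamma> t) \<le> I u"
    using convex_onD[OF conv, of t 0 1] t ends eq by (simp add: algebra_simps)
qed (rule convex_link_start_le[OF crit link t])

lemma strictly_convex_on_imp_convex_on:
  assumes "strictly_convex_on S f"
  shows "convex_on S f"
  unfolding convex_on_def
proof (intro conjI ballI allI impI)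
  show "convex S"
    using assms by (simp add: strictly_convex_on_def)
  fix x y and a b :: real
  assume xy: "x \<in> S" "y \<in> S" and ab: "0 \<le> a" "0 \<le> b" "a + b = 1"
  show "f (a *\<^sub>R x + b *\<^sub>R y) \<le> a * f x + b * f y"
  \<comment> \<open>Strictness concerns distinct points and positive weights only; in the degenerate
    cases both sides agree.\<close>
  proof (cases "x = y \<or> a = 0 \<or> b = 0")
    case True
    then show ?thesis
      using ab by (auto simp flip: scaleR_left_distrib distrib_right)
  next
    case False
    then show ?thesis
      using assms xy ab by (simp add: strictly_convex_on_def less_imp_le)
  qed
qed

lemma strictly_convex_link_imp_convex_link:
  "strictly_convex_link I u v \<gamma> \<Longrightarrow> convex_link I u v \<gamma>"
  by (simp add: strictly_convex_link_def convex_link_def strictly_convex_on_imp_convex_on)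

text \<open>With equal end values, strict convexity would push the midpoint of the path below
  \<open>I u\<close>, which is the minimum along it.\<close>

lemma strictly_convex_link_endpoints_neq:
  assumes crit: "critical_point I u" and link: "strictly_convex_link I u v \<gamma>"
  shows "I v \<noteq> I u"
proof
  assume eq: "I v = I u"
  have ends: "\<gamma> 0 = u" "\<gamma> 1 = v" and conv: "strictly_convex_on {0..1} (\<lambda>t. I (\<gamma> t))"
    using link by (auto simp: strictly_convex_link_def joins_def)
  have "I (\<gamma> ((1/2) *\<^sub>R 0 + (1/2) *\<^sub>R 1)) < 1/2 * I (\<gamma> 0) + 1/2 * I (\<gamma> 1)"
    using conv unfolding strictly_convex_on_def
    by (metis (no_types, lifting) atLeastAtMost_iff field_sum_of_halves half_gt_zero
        order_refl zero_le_one zero_less_one zero_neq_one)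
  moreover have "I u \<le> I (\<gamma> (1/2))"
    using convex_link_start_le[OF crit strictly_convex_link_imp_convex_link[OF link]] by simp
  ultimately show False
    using ends eq by simp
qed

theorem theorem1p1:
  fixes I :: "'a::real_normed_vector \<Rightarrow> real" and A :: "'a set"
  assumes "\<And>u. I differentiable (at u)"
    and "\<And>u. u \<in> A \<Longrightarrow> critical_point I u"
    and "\<And>u v. u \<in> A \<Longrightarrow> v \<in> A \<Longrightarrow> \<exists>\<gamma>. convex_link I u v \<gamma>"
  shows "I constant_on A
    \<and> (\<forall>u\<in>A. \<forall>v\<in>A. \<forall>\<gamma>. convex_link I u v \<gamma> \<longrightarrow> (\<lambda>t. I (\<gamma> t)) constant_on {0..1})
    \<and> ((\<forall>u\<in>A. \<forall>v\<in>A. u \<noteq> v \<longrightarrow> (\<exists>\<gamma>. strictly_convex_link I u v \<gamma>))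
        \<longrightarrow> (\<exists>\<^sub>\<le>\<^sub>1u. u \<in> A))"
proof -
  \<comment> \<open>Two links are used, one from \<open>u\<close> to \<open>v\<close> and one from
    \<open>v\<close> to \<open>u\<close>: reversing a single one could lose the Lipschitz condition
    at the start.\<close>
  have const: "I u = I v" if "u \<in> A" "v \<in> A" for u v
    using assms(2,3) that by (meson antisym convex_link_endpoint_le)
  have "I constant_on A"
    using const by (metis constant_on_def)
  moreover have "(\<lambda>t. I (\<gamma> t)) constant_on {0..1}"
    if "u \<in> A" "v \<in> A" "convex_link I u v \<gamma>" for u v \<gamma>
    using convex_link_constant[OF assms(2)[OF that(1)] that(3) const[OF that(2,1)]]
    by (auto simp: constant_on_def)
  \<comment> \<open>A strict link between two distinct points of \<open>A\<close> would separate
    their values, against \<open>const\<close>.\<close>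
  moreover have "\<exists>\<^sub>\<le>\<^sub>1u. u \<in> A"
    if "\<forall>u\<in>A. \<forall>v\<in>A. u \<noteq> v \<longrightarrow> (\<exists>\<gamma>. strictly_convex_link I u v \<gamma>)"
    using that assms(2) const strictly_convex_link_endpoints_neq
    unfolding Uniq_def by metis
  ultimately show ?thesis by blast
qed

end
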